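(* Let $\mathbf{X}=(X_n)_{n\in\mathbb{Z}}$ and $\mathbf{Y}=(Y_n)_{n\in\mathbb{Z}}$ be any two stationary chains on $\{0,1\}$. Then $$\bar d(\mathbf{X},\mathbf{Y})\ge|\mathbb{P}(Y_0=1)-\mathbb{P}(X_0=1)|.$$
   Context: For stationary processes $\mathbf{X},\mathbf{Y}$ on $\{0,1\}^{\mathbb{Z}}$, $$\bar d(\mathbf{X},\mathbf{Y})=\inf\{\mathbb{P}(\widetilde X_0\neq\widetilde Y_0): (\widetilde{\mathbf{X}},\widetilde{\mathbf{Y}})\text{ stationary coupling of }\mathbf{X}\text{ and }\mathbf{Y}\},$$ where a stationary coupling is a (jointly) stationary process on $(\{0,1\}\times\{0,1\})^{\mathbb{Z}}$ whose marginals have the laws of $\mathbf{X}$ and $\mathbf{Y}$. No ordering assumption between the chains is made. *)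

theory Defs
  imports "HOL-Probability.Probability"
begin

definition path_space :: "'s set \<Rightarrow> (int \<Rightarrow> 's) measure" where
  "path_space A = PiM UNIV (\<lambda>_. count_space A)"

definition process_law :: "'s set \<Rightarrow> 'w measure \<Rightarrow> (int \<Rightarrow> 'w \<Rightarrow> 's) \<Rightarrow> (int \<Rightarrow> 's) measure" where
  "process_law A M X = distr M (path_space A) (\<lambda>\<omega> n. X n \<omega>)"

text \<open>Measurability into \<open>count_space A\<close> includes that \<open>X n\<close> maps \<open>space M\<close> into \<open>A\<close>.\<close>

definition stationary_process :: "'s set \<Rightarrow> 'w measure \<Rightarrow> (int \<Rightarrow> 'w \<Rightarrow> 's) \<Rightarrow> bool" where
  "stationary_process A M X \<longleftrightarrow>
     prob_space M \<and> (\<forall>n. X n \<in> measurable M (count_space A)) \<and>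
     (\<forall>k. process_law A M (\<lambda>n. X (n + k)) = process_law A M X)"

text \<open>A coupling enters only through its joint law, so it is represented by a measure \<open>Q\<close> on
  the path space over pairs, with the coordinate maps as the process; this avoids quantifying
  over the type of an underlying sample space.\<close>

definition stationary_coupling ::
  "'a measure \<Rightarrow> (int \<Rightarrow> 'a \<Rightarrow> nat) \<Rightarrow> 'b measure \<Rightarrow> (int \<Rightarrow> 'b \<Rightarrow> nat) \<Rightarrow>
     (int \<Rightarrow> nat \<times> nat) measure \<Rightarrow> bool" where
  "stationary_coupling M X N Y Q \<longleftrightarrow>
     sets Q = sets (path_space ({0, 1} \<times> {0, 1})) \<and>
     stationary_process ({0, 1} \<times> {0, 1}) Q (\<lambda>n \<omega>. \<omega> n) \<and>
     process_law {0, 1} Q (\<lambda>n \<omega>. fst (\<omega> n)) = process_law {0, 1} M X \<and>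
     process_law {0, 1} Q (\<lambda>n \<omega>. snd (\<omega> n)) = process_law {0, 1} N Y"

text \<open>The infimum is over a nonempty set when \<open>X\<close> and \<open>Y\<close> are stationary, because
  the independent coupling is stationary.\<close>

definition dbar ::
  "'a measure \<Rightarrow> (int \<Rightarrow> 'a \<Rightarrow> nat) \<Rightarrow> 'b measure \<Rightarrow> (int \<Rightarrow> 'b \<Rightarrow> nat) \<Rightarrow> real" where
  "dbar M X N Y =
     Inf {\<P>(\<omega> in Q. fst (\<omega> 0) \<noteq> snd (\<omega> 0)) | Q. stationary_coupling M X N Y Q}"

end

theory Submission
  imports Defs
begin

text \<open>For any coupling, \<open>\<bar>P(Y\<^sub>0 = 1) - P(X\<^sub>0 = 1)\<bar> \<le> P(X\<^sub>0 \<noteq> Y\<^sub>0)\<close>, because the two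
  events differ only where \<open>X\<^sub>0 \<noteq> Y\<^sub>0\<close>. Since the real infimum of the empty set is a junk value, one
  also needs a stationary coupling to exist. The independent coupling is stationary because its
  law is the image of the product of the two marginal laws, which are invariant under shifts.\<close>

lemma space_path_space: "space (path_space A) = (UNIV \<rightarrow> A)"
  by (simp add: path_space_def space_PiM PiE_def)

lemma measurable_path_space:
  assumes "\<And>n. X n \<in> measurable M (count_space A)"
  shows "(\<lambda>\<omega> n. X n \<omega>) \<in> measurable M (path_space A)"
  unfolding path_space_def
  using assms measurable_space[OF assms] by (intro measurable_PiM_single') auto

lemma measurable_path_component:
  "(\<lambda>\<omega>. \<omega> n) \<in> measurable (path_space A) (count_space A)"
  unfolding path_space_def by (rule measurable_component_singleton) simp

text \<open>The pair is measurable for the product \<sigma>-algebra. Countability of both alphabets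
  turns that product of discrete spaces into the discrete space on \<open>A \<times> B\<close>, the
  form that \<open>path_space (A \<times> B)\<close> asks for.\<close>

lemma measurable_Pair_count_space:
  assumes "countable A" "countable B"
    and "f \<in> measurable M (count_space A)" "g \<in> measurable M (count_space B)"
  shows "(\<lambda>\<omega>. (f \<omega>, g \<omega>)) \<in> measurable M (count_space (A \<times> B))"
  using measurable_Pair[OF assms(3,4)] assms(1,2)
  by (simp add: pair_measure_countable)

text \<open>Used to turn an equality of process laws into an equality of one-time probabilities: the
  event depends on one coordinate, so its probability can be read off the law.\<close>

lemma measure_process_law_component:
  assumes "\<And>n. X n \<in> measurable M (count_space A)"
  shows "\<P>(\<omega> in process_law A M X. \<omega> m = a) = \<P>(\<omega> in M. X m \<omega> = a)"
proof -
  let ?E = "{\<omega> \<in> space (path_space A). \<omega> m = a}"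
  note X = measurable_path_space[OF assms]
  \<comment> \<open>The value \<open>a\<close> may lie outside \<open>A\<close>; intersecting with
    \<open>A\<close> makes the target a measurable subset of \<open>count_space A\<close> in either
    case.\<close>
  have "?E = (\<lambda>\<omega>. \<omega> m) -` ({a} \<inter> A) \<inter> space (path_space A)"
    by (auto simp: space_path_space)
  then have "?E \<in> sets (path_space A)"
    using measurable_sets[OF measurable_path_component[of m A], of "{a} \<inter> A"] by simp
  then have "measure (process_law A M X) ?E = measure M ((\<lambda>\<omega> n. X n \<omega>) -` ?E \<inter> space M)"
    unfolding process_law_def by (rule measure_distr[OF X])
  also have "(\<lambda>\<omega> n. X n \<omega>) -` ?E \<inter> space M = {\<omega> \<in> space M. X m \<omega> = a}"
    using measurable_space[OF X] by auto
  finally show ?thesis by (simp add: process_law_def)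
qed

text \<open>The right-hand side mentions the two processes only through their laws. So replacing
  either process by one with the same law, in particular by a shift of a stationary process, leaves
  the law of the independent pair unchanged.\<close>

lemma process_law_pair:
  assumes "prob_space M" "prob_space N" "countable A" "countable B"
    and X: "\<And>n. X n \<in> measurable M (count_space A)"
    and Y: "\<And>n. Y n \<in> measurable N (count_space B)"
  shows "process_law (A \<times> B) (M \<Otimes>\<^sub>M N) (\<lambda>n \<omega>. (X n (fst \<omega>), Y n (snd \<omega>))) =
    distr (process_law A M X \<Otimes>\<^sub>M process_law B N Y) (path_space (A \<times> B))
      (\<lambda>\<omega> n. (fst \<omega> n, snd \<omega> n))"
proof -
  note mX = measurable_path_space[OF X] and mY = measurable_path_space[OF Y]
  \<comment> \<open>The product of two image measures is the image of the product once the second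
    image measure is \<sigma>-finite; being a probability measure gives this.\<close>
  interpret L: prob_space "process_law B N Y"
    unfolding process_law_def using prob_space.prob_space_distr[OF assms(2) mY] .
  have zip: "(\<lambda>\<omega> n. (fst \<omega> n, snd \<omega> n))
      \<in> measurable (path_space A \<Otimes>\<^sub>M path_space B) (path_space (A \<times> B))"
    by (intro measurable_path_space measurable_Pair_count_space assms(3,4)
        measurable_compose[OF measurable_fst measurable_path_component]
        measurable_compose[OF measurable_snd measurable_path_component])
  have "process_law A M X \<Otimes>\<^sub>M process_law B N Y =
      distr (M \<Otimes>\<^sub>M N) (path_space A \<Otimes>\<^sub>M path_space B)
        (\<lambda>(x, y). (\<lambda>n. X n x, \<lambda>n. Y n y))"
    using pair_measure_distr[OF mX mY] L.sigma_finite_measure_axioms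
    by (simp add: process_law_def)
  moreover have "(\<lambda>(x, y). (\<lambda>n. X n x, \<lambda>n. Y n y))
      \<in> measurable (M \<Otimes>\<^sub>M N) (path_space A \<Otimes>\<^sub>M path_space B)"
    using mX mY by measurable
  ultimately show ?thesis
    using zip by (simp add: process_law_def distr_distr comp_def case_prod_beta)
qed

lemma process_law_distr:
  assumes "T \<in> measurable M M'" "\<And>n. X n \<in> measurable M' (count_space A)"
  shows "process_law A (distr M M' T) X = process_law A M (\<lambda>n \<omega>. X n (T \<omega>))"
  unfolding process_law_def
  using assms by (simp add: distr_distr measurable_path_space comp_def)

text \<open>Swapping the factors reduces this to the first projection, whose image measure is known
  when the discarded factor is a probability measure.\<close>

lemma distr_pair_snd:
  assumes "prob_space M" "prob_space N"
  shows "distr (M \<Otimes>\<^sub>M N) N snd = N"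
proof -
  interpret pair_prob_space M N
    using assms by (simp add: pair_prob_space_def pair_sigma_finite_def prob_space_imp_sigma_finite)
  have "distr (M \<Otimes>\<^sub>M N) N snd = distr (N \<Otimes>\<^sub>M M) N fst"
    by (subst distr_pair_swap) (simp add: distr_distr comp_def case_prod_beta)
  then show ?thesis using prob_space.distr_pair_fst[OF assms(1)] by simp
qed

lemma stationary_coupling_independent:
  assumes X: "stationary_process {0, 1} M X" and Y: "stationary_process {0, 1} N Y"
  defines "Q \<equiv> process_law ({0, 1} \<times> {0, 1}) (M \<Otimes>\<^sub>M N) (\<lambda>n \<omega>. (X n (fst \<omega>), Y n (snd \<omega>)))"
  shows "stationary_coupling M X N Y Q"
proof -
  let ?A = "{0, 1} :: nat set" and ?Z = "\<lambda>n \<omega>. (X n (fst \<omega>), Y n (snd \<omega>))"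
  have pM: "prob_space M" and pN: "prob_space N"
    and mX: "\<And>n. X n \<in> measurable M (count_space ?A)"
    and mY: "\<And>n. Y n \<in> measurable N (count_space ?A)"
    and sX: "\<And>k. process_law ?A M (\<lambda>n. X (n + k)) = process_law ?A M X"
    and sY: "\<And>k. process_law ?A N (\<lambda>n. Y (n + k)) = process_law ?A N Y"
    using X Y by (auto simp: stationary_process_def)
  interpret pair_prob_space M N
    using pM pN by (simp add: pair_prob_space_def pair_sigma_finite_def prob_space_imp_sigma_finite)
  have cA: "countable ?A" by simp
  have mZ: "?Z n \<in> measurable (M \<Otimes>\<^sub>M N) (count_space (?A \<times> ?A))" for n
    by (intro measurable_Pair_count_space cA measurable_compose[OF measurable_fst mX]
        measurable_compose[OF measurable_snd mY])
  have Q: "Q = distr (M \<Otimes>\<^sub>M N) (path_space (?A \<times> ?A)) (\<lambda>\<omega> n. ?Z n \<omega>)"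
    by (simp add: Q_def process_law_def)
  note mQ = measurable_path_space[OF mZ]
  have comp: "(\<lambda>\<omega>. \<omega> n) \<in> measurable (path_space (?A \<times> ?A)) (count_space (?A \<times> ?A))" for n
    by (rule measurable_path_component)
  have sets: "sets Q = sets (path_space (?A \<times> ?A))"
    by (simp add: Q)
  \<comment> \<open>The right-hand side is \<open>Q\<close> itself, so the case \<open>k = 0\<close>
    says that \<open>Q\<close> is the law of its own coordinate process, and the other cases then
    give stationarity.\<close>
  have law: "process_law (?A \<times> ?A) Q (\<lambda>n \<omega>. \<omega> (n + k)) = Q" for k
  proof -
    have "process_law (?A \<times> ?A) Q (\<lambda>n \<omega>. \<omega> (n + k)) =
        process_law (?A \<times> ?A) (M \<Otimes>\<^sub>M N) (\<lambda>n. ?Z (n + k))"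
      unfolding Q by (rule process_law_distr[OF mQ comp])
    \<comment> \<open>By \<open>process_law_pair\<close>, the shifted and the unshifted pair are
      images of a product of marginal laws under the same map; \<open>sX\<close> and
      \<open>sY\<close> identify the factors.\<close>
    also have "\<dots> = Q"
      unfolding Q_def
      using process_law_pair[OF pM pN cA cA mX mY]
        process_law_pair[OF pM pN cA cA, of "\<lambda>n. X (n + k)" "\<lambda>n. Y (n + k)", OF mX mY]
      by (simp only: sX sY)
    finally show ?thesis .
  qed
  have "prob_space Q"
    unfolding Q using mQ by (rule prob_space_distr)
  moreover have "(\<lambda>\<omega>. \<omega> n) \<in> measurable Q (count_space (?A \<times> ?A))" for n
    unfolding Q using comp by simp
  ultimately have "stationary_process (?A \<times> ?A) Q (\<lambda>n \<omega>. \<omega> n)"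
    using law law[of 0] by (simp add: stationary_process_def)
  moreover have "process_law ?A Q (\<lambda>n \<omega>. fst (\<omega> n)) = process_law ?A M X"
  proof -
    have "(\<lambda>\<omega>. fst (\<omega> n)) \<in> measurable (path_space (?A \<times> ?A)) (count_space ?A)" for n
      by (rule measurable_compose[OF comp]) auto
    then have "process_law ?A Q (\<lambda>n \<omega>. fst (\<omega> n)) = process_law ?A (M \<Otimes>\<^sub>M N) (\<lambda>n \<omega>. X n (fst \<omega>))"
      unfolding Q by (subst process_law_distr[OF mQ]) simp_all
    \<comment> \<open>The first component is \<open>X\<close> pulled back along \<open>fst\<close>,
      so its law is that of \<open>X\<close> under the image of the product by \<open>fst\<close>,
      which is \<open>M\<close>.\<close>
    also have "\<dots> = process_law ?A (distr (M \<Otimes>\<^sub>M N) M fst) X"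
      by (rule process_law_distr[OF measurable_fst mX, symmetric])
    finally show ?thesis by (simp add: prob_space.distr_pair_fst[OF pN])
  qed
  moreover have "process_law ?A Q (\<lambda>n \<omega>. snd (\<omega> n)) = process_law ?A N Y"
  proof -
    have "(\<lambda>\<omega>. snd (\<omega> n)) \<in> measurable (path_space (?A \<times> ?A)) (count_space ?A)" for n
      by (rule measurable_compose[OF comp]) auto
    then have "process_law ?A Q (\<lambda>n \<omega>. snd (\<omega> n)) = process_law ?A (M \<Otimes>\<^sub>M N) (\<lambda>n \<omega>. Y n (snd \<omega>))"
      unfolding Q by (subst process_law_distr[OF mQ]) simp_all
    also have "\<dots> = process_law ?A (distr (M \<Otimes>\<^sub>M N) N snd) Y"
      by (rule process_law_distr[OF measurable_snd mY, symmetric])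
    finally show ?thesis by (simp add: distr_pair_snd[OF pM pN])
  qed
  ultimately show ?thesis
    using sets by (simp add: stationary_coupling_def)
qed

text \<open>Each of the events \<open>P\<close> and \<open>R\<close> is contained in the union of
  the other with \<open>D\<close>. Subadditivity gives one inequality per direction, and together
  they bound the absolute value.\<close>

lemma (in prob_space) abs_prob_diff_le:
  assumes "{\<omega> \<in> space M. P \<omega>} \<in> events" "{\<omega> \<in> space M. R \<omega>} \<in> events"
    and "{\<omega> \<in> space M. D \<omega>} \<in> events"
    and "\<And>\<omega>. \<omega> \<in> space M \<Longrightarrow> P \<omega> \<noteq> R \<omega> \<Longrightarrow> D \<omega>"
  shows "\<bar>\<P>(\<omega> in M. R \<omega>) - \<P>(\<omega> in M. P \<omega>)\<bar> \<le> \<P>(\<omega> in M. D \<omega>)"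
proof -
  have le: "\<P>(\<omega> in M. U \<omega>) \<le> \<P>(\<omega> in M. V \<omega>) + \<P>(\<omega> in M. D \<omega>)"
    if "{\<omega> \<in> space M. V \<omega>} \<in> events" "\<And>\<omega>. \<omega> \<in> space M \<Longrightarrow> U \<omega> \<Longrightarrow> V \<omega> \<or> D \<omega>" for U V
  proof -
    have "\<P>(\<omega> in M. U \<omega>) \<le> prob ({\<omega> \<in> space M. V \<omega>} \<union> {\<omega> \<in> space M. D \<omega>})"
      using that assms(3) by (intro finite_measure_mono) auto
    also have "\<dots> \<le> \<P>(\<omega> in M. V \<omega>) + \<P>(\<omega> in M. D \<omega>)"
      using that(1) assms(3) by (rule measure_Un_le)
    finally show ?thesis .
  qed
  show ?thesis
    using le[OF assms(1), of R] le[OF assms(2), of P] assms(4) by (smt (verit))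
qed

lemma stationary_coupling_disagreement:
  assumes X: "\<And>n. X n \<in> measurable M (count_space {0, 1})"
    and Y: "\<And>n. Y n \<in> measurable N (count_space {0, 1})"
    and Q: "stationary_coupling M X N Y Q"
  shows "\<bar>\<P>(\<omega> in N. Y 0 \<omega> = 1) - \<P>(\<omega> in M. X 0 \<omega> = 1)\<bar> \<le> \<P>(\<omega> in Q. fst (\<omega> 0) \<noteq> snd (\<omega> 0))"
proof -
  let ?A = "{0, 1} :: nat set"
  have comp: "\<And>n. (\<lambda>\<omega>. \<omega> n) \<in> measurable Q (count_space (?A \<times> ?A))" and "prob_space Q"
    and law: "process_law ?A Q (\<lambda>n \<omega>. fst (\<omega> n)) = process_law ?A M X"
      "process_law ?A Q (\<lambda>n \<omega>. snd (\<omega> n)) = process_law ?A N Y"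
    using Q by (auto simp: stationary_coupling_def stationary_process_def)
  interpret prob_space Q by fact
  \<comment> \<open>The coordinate at time 0 takes values in a discrete space, so an arbitrary
    predicate of it defines an event. This covers both marginal events and the disagreement
    event.\<close>
  have ev: "{\<omega> \<in> space Q. P (\<omega> 0)} \<in> events" for P
  proof -
    have "(\<lambda>\<omega>. P (\<omega> 0)) \<in> measurable Q (count_space UNIV)"
      by (rule measurable_compose[OF comp]) auto
    then show ?thesis by (simp add: pred_def)
  qed
  have "(\<lambda>\<omega>. fst (\<omega> n)) \<in> measurable Q (count_space ?A)" for n
    by (rule measurable_compose[OF comp]) auto
  then have 1: "\<P>(\<omega> in Q. fst (\<omega> 0) = 1) = \<P>(\<omega> in M. X 0 \<omega> = 1)"
    using measure_process_law_component[where m = 0 and a = 1, OF X]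
      measure_process_law_component[where X = "\<lambda>n \<omega>. fst (\<omega> n)" and M = Q and A = ?A and m = 0 and a = 1]
    by (simp only: law(1))
  have "(\<lambda>\<omega>. snd (\<omega> n)) \<in> measurable Q (count_space ?A)" for n
    by (rule measurable_compose[OF comp]) auto
  then have 2: "\<P>(\<omega> in Q. snd (\<omega> 0) = 1) = \<P>(\<omega> in N. Y 0 \<omega> = 1)"
    using measure_process_law_component[where m = 0 and a = 1, OF Y]
      measure_process_law_component[where X = "\<lambda>n \<omega>. snd (\<omega> n)" and M = Q and A = ?A and m = 0 and a = 1]
    by (simp only: law(2))
  \<comment> \<open>Both probabilities are now taken under \<open>Q\<close>. If exactly one of the
    two coordinates at time 0 equals 1, the coordinates differ, so disagreement can serve as
    \<open>D\<close>.\<close>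
  show ?thesis
    unfolding 1[symmetric] 2[symmetric] by (rule abs_prob_diff_le; (rule ev)?) auto
qed

theorem lemma1:
  fixes M :: "'a measure" and N :: "'b measure"
    and X :: "int \<Rightarrow> 'a \<Rightarrow> nat" and Y :: "int \<Rightarrow> 'b \<Rightarrow> nat"
  assumes "stationary_process {0, 1} M X"
    and "stationary_process {0, 1} N Y"
  shows "dbar M X N Y \<ge> \<bar>\<P>(\<omega> in N. Y 0 \<omega> = 1) - \<P>(\<omega> in M. X 0 \<omega> = 1)\<bar>"
  unfolding dbar_def
proof (rule cInf_greatest)
  show "{\<P>(\<omega> in Q. fst (\<omega> 0) \<noteq> snd (\<omega> 0)) | Q. stationary_coupling M X N Y Q} \<noteq> {}"
    using stationary_coupling_independent[OF assms] by blast
next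
  fix r
  assume "r \<in> {\<P>(\<omega> in Q. fst (\<omega> 0) \<noteq> snd (\<omega> 0)) | Q. stationary_coupling M X N Y Q}"
  then show "\<bar>\<P>(\<omega> in N. Y 0 \<omega> = 1) - \<P>(\<omega> in M. X 0 \<omega> = 1)\<bar> \<le> r"
    using stationary_coupling_disagreement[of X M Y N] assms
    unfolding stationary_process_def by blast
qed

end
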